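(* Let $m=\bar p_1^{e_1}\cdots \bar p_r^{e_r}$ with $r\ge 1$, primes $\bar p_1<\dots<\bar p_r$ and exponents $e_i\ge 1$, be a deficient number with $c(m)\ge \bar p_r$. Then there exist primes $p,q$ with $\bar p_r<p<q$ such that $mp$ is deficient and $mpq$ is abundant. Moreover, if $m$ is square-free, then $mpq$ is a primitive abundant number.
   Context: For $n\in\mathbb{N}$, $\sigma(n)=\sum_{d\mid n}d$. $n$ is deficient if $\sigma(n)<2n$, perfect if $\sigma(n)=2n$, abundant if $\sigma(n)>2n$, and non-deficient if perfect or abundant. The deficiency is $d(n)=2n-\sigma(n)$ and the center is $c(n)=\sigma(n)/d(n)$. A primitive abundant number is an abundant number all of whose proper divisors are deficient. *)

theory Defs
  imports Complex_Main "HOL-Computational_Algebra.Squarefree"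
begin

text \<open>
  The index set is infinite for argument \<open>0\<close>, so the sum is then \<open>0\<close>; consequently \<open>0\<close> is neither
  deficient nor abundant in the sense below.
\<close>

definition divisor_sum :: "nat \<Rightarrow> nat" where
  "divisor_sum n = (\<Sum>d | d dvd n. d)"

definition deficient :: "nat \<Rightarrow> bool" where
  "deficient n \<longleftrightarrow> divisor_sum n < 2 * n"

definition abundant :: "nat \<Rightarrow> bool" where
  "abundant n \<longleftrightarrow> divisor_sum n > 2 * n"

definition deficiency :: "nat \<Rightarrow> int" where
  "deficiency n = 2 * int n - int (divisor_sum n)"

definition center :: "nat \<Rightarrow> real" where
  "center n = real (divisor_sum n) / real_of_int (deficiency n)"

definition primitive_abundant :: "nat \<Rightarrow> bool" where
  "primitive_abundant n \<longleftrightarrow> abundant n \<and> (\<forall>d. d dvd n \<and> d \<noteq> n \<longrightarrow> deficient d)"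

end

theory Submission
  imports Defs "HOL-Library.Discrete_Functions"
begin

text \<open>
  Put \<open>c = center m\<close>. For a prime \<open>p\<close> not dividing \<open>m\<close>, the number \<open>m p\<close> is deficient iff
  \<open>c < p\<close>, and for a further prime \<open>q\<close>, \<open>m p q\<close> is abundant iff \<open>p q < c (p + q + 1)\<close>. The latter holds
  in particular if \<open>p, q \<le> 2 c\<close>, so it suffices to find two primes between \<open>c\<close> and \<open>2 c\<close>. This is
  Erdos's proof of Bertrand's postulate: if \<open>(n, 2 n]\<close> contained at most one prime, the central
  binomial coefficient would be smaller than \<open>4 ^ n / (2 n)\<close>; one exceptional prime costs only a
  further factor \<open>2 n\<close>. Small \<open>n\<close> are covered by a chain of pairs of primes.

  For square-free \<open>m\<close>, it remains to remove a prime \<open>s\<close> from \<open>m p q\<close>. If \<open>s\<close> is \<open>p\<close> or \<open>q\<close>, the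
  result is deficient because \<open>c < p < q\<close>. Otherwise \<open>s < q\<close>, and \<open>m p q / s\<close> arises from the deficient
  number \<open>m p\<close> by replacing the simple prime factor \<open>s\<close> by the larger \<open>q\<close>, which decreases
  \<open>divisor_sum n / n\<close>.
\<close>

section \<open>Two primes between \<open>n\<close> and \<open>2 n\<close>\<close>

lemma prod_primes_dvd:
  fixes n :: nat
  assumes "finite S" "\<And>p. p \<in> S \<Longrightarrow> prime p" "\<And>p. p \<in> S \<Longrightarrow> p dvd n"
  shows "\<Prod>S dvd n"
  using assms
proof (induction S rule: finite_induct)
  case (insert p S)
  have "coprime p (\<Prod>S)"
    using insert by (intro prod_coprime_right primes_coprime) auto
  then show ?case
    using insert by (auto intro: divides_mult)
qed simp

text \<open>The two middle entries of row \<open>2 * m + 1\<close> are equal, and together they are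
  at most the row sum \<open>2 * 4 ^ m\<close>.\<close>

lemma odd_binomial_le: "(2 * m + 1) choose m \<le> 4 ^ m"
proof -
  have "2 * ((2 * m + 1) choose m) = (\<Sum>k\<in>{m, Suc m}. (2 * m + 1) choose k)"
    using binomial_symmetric[of m "2 * m + 1"] by (simp add: Suc_diff_le)
  also have "\<dots> \<le> (\<Sum>k\<le>2 * m + 1. (2 * m + 1) choose k)"
    by (intro sum_mono2) auto
  also have "\<dots> = 2 * 4 ^ m"
    unfolding choose_row_sum by (simp add: power_mult)
  finally show ?thesis by simp
qed

text \<open>Strong induction. An even \<open>n > 2\<close> adds no prime. For
  \<open>n = 2 * m + 1\<close>, the primes in \<open>(m + 1, n]\<close> divide \<open>n!\<close> but
  neither \<open>m!\<close> nor \<open>(m + 1)!\<close>, so their product divides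
  \<open>n choose m\<close>, which is at most \<open>4 ^ m\<close>; the primes up to
  \<open>m + 1\<close> are covered by induction.\<close>

lemma primorial_le: "\<Prod>{p. prime p \<and> p \<le> n} \<le> (4::nat) ^ n"
proof (induction n rule: less_induct)
  case (less n)
  show ?case
  proof (cases "n \<le> 2")
    case True
    have "{p::nat. prime p \<and> p \<le> n} = (if n = 2 then {2} else {})"
      using True by (auto dest: prime_ge_2_nat)
    then show ?thesis by simp
  next
    case False
    show ?thesis
    proof (cases "even n")
      case True
      have "{p. prime p \<and> p \<le> n} = {p. prime p \<and> p \<le> n - 1}"
        using True False primes_dvd_imp_eq[of 2 n] by (auto simp: le_eq_less_or_eq)
      then have "\<Prod>{p. prime p \<and> p \<le> n} \<le> (4::nat) ^ (n - 1)"
        using less[of "n - 1"] False by simp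
      also have "\<dots> \<le> 4 ^ n" by (intro power_increasing) auto
      finally show ?thesis .
    next
      case odd: False
      then obtain m where m: "n = 2 * m + 1" by (elim oddE)
      let ?A = "{p. prime p \<and> p \<le> m + 1}" and ?B = "{p. prime p \<and> m + 1 < p \<and> p \<le> n}"
      have fin: "finite ?A" "finite ?B" by (rule finite_subset[of _ "{..n + m + 1}"]; auto)+
      have "\<Prod>?B dvd (n choose m)"
      proof (rule prod_primes_dvd)
        fix p assume p: "p \<in> ?B"
        have "p dvd fact n" using p by (simp add: prime_dvd_fact_iff)
        also have "fact n = fact m * fact (m + 1) * (n choose m)"
          using binomial_fact_lemma[of m n] by (simp add: m Suc_diff_le)
        finally show "p dvd (n choose m)"
          using p by (auto simp: prime_dvd_mult_iff prime_dvd_fact_iff simp del: fact_Suc)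
      qed (use fin in auto)
      then have "\<Prod>?B \<le> n choose m" by (rule dvd_imp_le) (simp add: m)
      then have B: "\<Prod>?B \<le> 4 ^ m" using odd_binomial_le[of m] by (simp add: m)
      have "{p. prime p \<and> p \<le> n} = ?A \<union> ?B" by (auto simp: m)
      then have "\<Prod>{p. prime p \<and> p \<le> n} = \<Prod>?A * \<Prod>?B"
        using fin by (simp, intro prod.union_disjoint) auto
      also have "\<dots> \<le> 4 ^ (m + 1) * 4 ^ m"
        using less[of "m + 1"] B False by (intro mult_mono) (auto simp: m)
      also have "\<dots> = 4 ^ n" by (simp add: m power_add[symmetric] mult_2)
      finally show ?thesis .
    qed
  qed
qed

section \<open>Prime powers in the central binomial coefficient\<close>

lemma multiplicity_eq_sum_dvd:
  fixes p n :: nat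
  assumes "prime p" "0 < n" "n < p ^ Suc K"
  shows "multiplicity p n = (\<Sum>i=1..K. of_bool (p ^ i dvd n))"
proof -
  have "p ^ multiplicity p n \<le> n"
    using assms by (intro dvd_imp_le multiplicity_dvd) auto
  then have "p ^ multiplicity p n < p ^ Suc K" using assms by simp
  then have "multiplicity p n < Suc K"
    using prime_gt_1_nat[OF assms(1)] by (rule power_less_imp_less_exp[rotated])
  then have "multiplicity p n \<le> K" by simp
  then have "{1..K} \<inter> {i. p ^ i dvd n} = {1..multiplicity p n}"
    using assms(1,2) prime_gt_1_nat[of p] by (auto simp: power_dvd_iff_le_multiplicity)
  then show ?thesis by (simp add: of_bool_def sum.If_cases)
qed

text \<open>Legendre's formula, cut off at an explicit \<open>K\<close> to keep the sum finite. From
  \<open>n\<close> to \<open>Suc n\<close>, the quotient by \<open>p ^ i\<close> grows by one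
  exactly when \<open>p ^ i\<close> divides \<open>Suc n\<close>.\<close>

lemma multiplicity_fact:
  fixes p n :: nat
  assumes "prime p" "n < p ^ Suc K"
  shows "multiplicity p (fact n) = (\<Sum>i=1..K. n div p ^ i)"
  using assms(2)
proof (induction n)
  case (Suc n)
  have "multiplicity p (fact (Suc n)) = multiplicity p (Suc n) + multiplicity p (fact n)"
    using assms by (simp add: prime_elem_multiplicity_mult_distrib del: mult_Suc)
  also have "\<dots> = (\<Sum>i=1..K. of_bool (p ^ i dvd Suc n) + n div p ^ i)"
    using multiplicity_eq_sum_dvd[OF assms(1), of "Suc n" K] Suc by (simp add: sum.distrib)
  also have "\<dots> = (\<Sum>i=1..K. Suc n div p ^ i)"
    by (intro sum.cong) (auto simp: div_Suc mod_eq_0_iff_dvd)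
  finally show ?case .
qed simp

lemma multiplicity_central_binomial:
  fixes p n :: nat
  assumes "prime p" "2 * n < p ^ Suc K"
  shows "multiplicity p ((2 * n) choose n) = (\<Sum>i=1..K. 2 * n div p ^ i - 2 * (n div p ^ i))"
proof -
  have "fact (2 * n) = fact n * fact n * ((2 * n) choose n)"
    using binomial_fact_lemma[of n "2 * n"] by simp
  then have "multiplicity p (fact (2 * n)) = 2 * multiplicity p (fact n) + multiplicity p ((2 * n) choose n)"
    using assms by (simp add: prime_elem_multiplicity_mult_distrib)
  moreover have "multiplicity p (fact n) = (\<Sum>i=1..K. n div p ^ i)"
    "multiplicity p (fact (2 * n)) = (\<Sum>i=1..K. 2 * n div p ^ i)"
    by (rule multiplicity_fact[OF assms(1)], use assms(2) in linarith)+
  ultimately have "multiplicity p ((2 * n) choose n) = (\<Sum>i=1..K. 2 * n div p ^ i) - (\<Sum>i=1..K. 2 * (n div p ^ i))"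
    by (simp add: sum_distrib_left)
  also have "\<dots> = (\<Sum>i=1..K. 2 * n div p ^ i - 2 * (n div p ^ i))"
  proof (rule sum_subtractf_nat[symmetric])
    fix i show "2 * (n div p ^ i) \<le> 2 * n div p ^ i"
      using assms(1) by (simp add: less_eq_div_iff_mult_less_eq prime_gt_0_nat)
  qed
  finally show ?thesis .
qed

text \<open>In Legendre's formula each of the \<open>K\<close> terms is at most 1, since doubling
  \<open>n\<close> doubles its quotient up to a carry of 1. For \<open>K\<close> the largest
  exponent with \<open>p ^ K \<le> 2 * n\<close>, this bounds the multiplicity by
  \<open>K\<close>.\<close>

lemma prime_power_central_binomial_le:
  fixes p n :: nat
  assumes "prime p" "0 < n"
  shows "p ^ multiplicity p ((2 * n) choose n) \<le> 2 * n"
proof -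
  obtain K where K: "p ^ K \<le> 2 * n" "2 * n < p ^ Suc K"
    using ex_power_ivl1[of p "2 * n"] assms prime_ge_2_nat[of p] by auto
  have "2 * n div q - 2 * (n div q) \<le> 1" for q
  proof (cases "q = 0")
    case False
    have "n < q * (n div q) + q"
      using False mult_div_mod_eq[of q n] mod_less_divisor[of q n] by linarith
    then have "2 * n < q * (2 * (n div q) + 2)" by (simp add: algebra_simps)
    then have "2 * n div q < 2 * (n div q) + 2"
      using False by (simp add: div_less_iff_less_mult mult.commute)
    then show ?thesis by simp
  qed simp
  then have "(\<Sum>i=1..K. 2 * n div p ^ i - 2 * (n div p ^ i)) \<le> (\<Sum>i=1..K. 1)"
    by (intro sum_mono)
  then have "multiplicity p ((2 * n) choose n) \<le> K"
    using multiplicity_central_binomial[OF assms(1) K(2)] by simp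
  then have "p ^ multiplicity p ((2 * n) choose n) \<le> p ^ K"
    using assms by (intro power_increasing) (auto dest: prime_ge_1_nat)
  with K show ?thesis by simp
qed

text \<open>As \<open>2 * n < 3 * p \<le> p * p\<close>, only the term \<open>i = 1\<close> remains,
  and it is \<open>2 - 2 * 1\<close>. Primes between \<open>2 * n / 3\<close> and \<open>n\<close>
  thus contribute nothing.\<close>

lemma multiplicity_central_binomial_eq_0:
  fixes p n :: nat
  assumes "prime p" "3 \<le> p" "2 * n < 3 * p" "p \<le> n"
  shows "multiplicity p ((2 * n) choose n) = 0"
proof -
  have "3 * p \<le> p * p" using assms by simp
  then have "2 * n < p ^ Suc 1" using assms(3) by (simp only: power_Suc power_0 One_nat_def mult_1_right)
  moreover have "n div p = 1" "2 * n div p = 2"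
    using assms by (intro div_nat_eqI; simp)+
  ultimately show ?thesis
    using multiplicity_central_binomial[OF assms(1), of n 1] by simp
qed

text \<open>The primes are split by size. Each of the at most \<open>floor_sqrt (2 * n)\<close>
  primes in \<open>?A\<close> contributes at most \<open>2 * n\<close>; those in \<open>?B\<close>
  exceed the square root, so they occur at most once and the primorial bound applies; those in
  \<open>?D\<close> contribute at most \<open>2 * n\<close> each.\<close>

lemma central_binomial_le:
  assumes "5 \<le> n"
  shows "(2 * n) choose n \<le>
    (2 * n) ^ floor_sqrt (2 * n) * 4 ^ (2 * n div 3) * (2 * n) ^ card {p. prime p \<and> n < p \<and> p \<le> 2 * n}"
proof -
  let ?C = "(2 * n) choose n" and ?s = "floor_sqrt (2 * n)"
  let ?f = "\<lambda>p. p ^ multiplicity p ?C"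
  let ?A = "{p. prime p \<and> p \<le> ?s}" and ?B = "{p. prime p \<and> ?s < p \<and> p \<le> 2 * n div 3}"
  let ?D = "{p. prime p \<and> n < p \<and> p \<le> 2 * n}"
  have fin: "finite ?A" "finite ?B" "finite ?D"
    by (rule finite_subset[of _ "{..2 * n + ?s}"]; auto)+
  have "?s \<le> n" using floor_sqrt_less_eq_half[of "2 * n"] by simp
  have f_le: "?f p \<le> 2 * n" if "prime p" for p
    using prime_power_central_binomial_le that assms by simp
  have f_le': "?f p \<le> p" if "prime p" "?s < p" for p
  proof -
    have "2 * n < p ^ 2"
      using that(2) by (simp add: not_le[symmetric] le_floor_sqrt_iff)
    then have "p ^ multiplicity p ?C < p ^ 2"
      using f_le[OF that(1)] by simp
    then have "multiplicity p ?C < 2"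
      using that(1) by (subst (asm) power_strict_increasing_iff) (auto dest: prime_gt_1_nat)
    then have "?f p \<le> p ^ 1"
      using that(1) by (intro power_increasing) (auto dest: prime_ge_1_nat)
    then show ?thesis by simp
  qed
  have "?C = (\<Prod>p\<in>prime_factors ?C. ?f p)"
    by (rule prime_factorization_nat) simp
  also have "\<dots> = (\<Prod>p\<in>prime_factors ?C \<inter> (?A \<union> ?B \<union> ?D). ?f p)"
  proof (rule prod.mono_neutral_right)
    show "\<forall>p\<in>prime_factors ?C - prime_factors ?C \<inter> (?A \<union> ?B \<union> ?D). ?f p = 1"
    proof
      fix p assume p: "p \<in> prime_factors ?C - prime_factors ?C \<inter> (?A \<union> ?B \<union> ?D)"
      then have "prime p" "p dvd ?C" by auto
      have "?C dvd fact (2 * n)"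
        using binomial_fact_lemma[of n "2 * n"] by (metis dvd_triv_right le_add1 mult_2)
      then have "p dvd fact (2 * n)" using \<open>p dvd ?C\<close> by (rule dvd_trans[rotated])
      then have "p \<le> 2 * n" using \<open>prime p\<close> by (simp add: prime_dvd_fact_iff)
      \<comment> \<open>With \<open>5 \<le> n\<close> the first inequality also forces
        \<open>3 \<le> p\<close>, as the vanishing lemma requires.\<close>
      then have "2 * n div 3 < p" "p \<le> n" using p \<open>prime p\<close> by auto
      then have "multiplicity p ?C = 0"
        using \<open>prime p\<close> assms by (intro multiplicity_central_binomial_eq_0) auto
      then show "?f p = 1" by simp
    qed
  qed auto
  also have "\<dots> \<le> (\<Prod>p\<in>?A \<union> ?B \<union> ?D. ?f p)"
    using fin by (intro dvd_imp_le prod_dvd_prod_subset prod_pos) (auto dest: prime_gt_0_nat)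
  also have "\<dots> = prod ?f (?A \<union> ?B) * prod ?f ?D"
    using fin \<open>?s \<le> n\<close> by (intro prod.union_disjoint) auto
  also have "prod ?f (?A \<union> ?B) = prod ?f ?A * prod ?f ?B"
    using fin by (intro prod.union_disjoint) auto
  also have "prod ?f ?A * prod ?f ?B * prod ?f ?D \<le> (2 * n) ^ ?s * 4 ^ (2 * n div 3) * (2 * n) ^ card ?D"
  proof (intro mult_mono)
    have "prod ?f ?A \<le> (\<Prod>p\<in>?A. 2 * n)"
      using f_le by (intro prod_mono) auto
    also have "\<dots> = (2 * n) ^ card ?A" by simp
    also have "\<dots> \<le> (2 * n) ^ ?s"
    proof (rule power_increasing)
      have "card ?A \<le> card {1..?s}" by (intro card_mono) (auto dest: prime_ge_1_nat)
      then show "card ?A \<le> ?s" by simp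
    qed (use assms in simp)
    finally show "prod ?f ?A \<le> (2 * n) ^ ?s" .
    have "prod ?f ?B \<le> \<Prod>?B"
      using f_le' by (intro prod_mono) auto
    also have "\<dots> \<le> \<Prod>{p. prime p \<and> p \<le> 2 * n div 3}"
      by (intro dvd_imp_le prod_dvd_prod_subset prod_pos) (auto dest: prime_gt_0_nat)
    also have "\<dots> \<le> 4 ^ (2 * n div 3)" by (rule primorial_le)
    finally show "prod ?f ?B \<le> 4 ^ (2 * n div 3)" .
    have "prod ?f ?D \<le> (\<Prod>p\<in>?D. 2 * n)"
      using f_le by (intro prod_mono) auto
    then show "prod ?f ?D \<le> (2 * n) ^ card ?D" by simp
  qed auto
  finally show ?thesis .
qed

section \<open>Two primes between \<open>n\<close> and \<open>2 * n\<close>, for large and for small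
  \<open>n\<close>\<close>

lemma two_primes_large:
  fixes n :: nat
  assumes "2048 \<le> n"
  shows "2 \<le> card {p. prime p \<and> n < p \<and> p \<le> 2 * n}"
proof (rule ccontr)
  let ?s = "floor_sqrt (2 * n)" and ?D = "{p. prime p \<and> n < p \<and> p \<le> 2 * n}"
  assume "\<not> ?thesis"
  then have card: "card ?D \<le> 1" by simp
  have s64: "64 \<le> ?s" using assms by (simp add: le_floor_sqrt_iff)
  \<comment> \<open>\<open>t\<close> is the integer part of the binary logarithm of
    \<open>?s\<close>; it turns the estimate into a comparison of exponents of 2.\<close>
  obtain t where t: "2 ^ t \<le> ?s" "?s < 2 ^ Suc t"
    using ex_power_ivl1[of 2 ?s] s64 by auto
  have "2 ^ 6 < (2::nat) ^ Suc t" using s64 t by simp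
  then have t6: "6 \<le> t" by (subst (asm) power_strict_increasing_iff) auto
  have "2 * n < (Suc ?s)\<^sup>2" by (rule Suc_floor_sqrt_power2_gt)
  also have "\<dots> \<le> (2 ^ Suc t)\<^sup>2" using t by (intro power_mono) auto
  finally have n_le: "2 * n \<le> 2 ^ (2 * (t + 1))" by (simp add: power_mult[symmetric] mult.commute)
  have "4 ^ n \<le> 2 * n * ((2 * n) choose n)"
  proof -
    have "4 ^ n / (2 * real n) \<le> real ((2 * n) choose n)"
      using assms by (intro central_binomial_lower_bound) simp
    then have "real (4 ^ n) \<le> real (2 * n * ((2 * n) choose n))"
      using assms by (simp add: field_simps)
    then show ?thesis by (simp only: of_nat_le_iff)
  qed
  also have "\<dots> \<le> 2 * n * ((2 * n) ^ ?s * 4 ^ (2 * n div 3) * (2 * n) ^ card ?D)"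
    using assms by (intro mult_left_mono central_binomial_le) auto
  also have "\<dots> \<le> 2 * n * ((2 * n) ^ ?s * 4 ^ (2 * n div 3) * (2 * n) ^ 1)"
    using assms card by (intro mult_left_mono power_increasing) auto
  also have "\<dots> = (2 * n) ^ (?s + 2) * 4 ^ (2 * n div 3)"
    by (simp add: power_add power2_eq_square)
  also have "\<dots> \<le> (2 ^ (2 * (t + 1))) ^ (?s + 2) * 4 ^ (2 * n div 3)"
    using n_le by (intro mult_right_mono power_mono) auto
  also have "\<dots> = 2 ^ (2 * (t + 1) * (?s + 2) + 2 * (2 * n div 3))"
    unfolding power_add power_mult by simp
  finally have "(2::nat) ^ (2 * n) \<le> \<dots>" by (simp add: power_mult)
  then have "2 * n \<le> 2 * (t + 1) * (?s + 2) + 2 * (2 * n div 3)"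
    by (subst (asm) power_increasing_iff) auto
  \<comment> \<open>At least a third of \<open>2 * n\<close> is left after subtracting
    \<open>2 * (2 * n div 3)\<close>.\<close>
  then have "2 * n \<le> 6 * ((t + 1) * (?s + 2))" by linarith
  moreover have "?s * ?s \<le> 2 * n" using floor_sqrt_power2_le[of "2 * n"] by (simp add: power2_eq_square)
  \<comment> \<open>At \<open>t = 6\<close> this reads \<open>63 \<le> 64\<close>, and it fails at
    \<open>t = 5\<close>. Hence the threshold 2048, which makes \<open>?s\<close> at least
    \<open>2 ^ 6\<close>.\<close>
  moreover have "9 * (t + 1) \<le> 2 ^ t" using t6
    by (induction t rule: dec_induct) auto
  then have "9 * (t + 1) * ?s \<le> ?s * ?s" using t by (intro mult_right_mono) auto
  ultimately have "(t + 1) * (9 * ?s) \<le> (t + 1) * (6 * (?s + 2))" by (simp add: algebra_simps)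
  then have "9 * ?s \<le> 6 * (?s + 2)" by (subst (asm) mult_le_cancel1) simp
  then show False using s64 by simp
qed

text \<open>Trial division: two factors that are both at least \<open>s\<close> would have a product
  of at least the square of \<open>s\<close>. The explicit list lets simplification check the
  candidates one by one.\<close>

lemma prime_nat_sqrtI:
  fixes n :: nat
  assumes "1 < n" "n < s\<^sup>2" "\<forall>d\<in>set [2..<s]. \<not> d dvd n"
  shows "prime n"
proof (rule ccontr)
  assume "\<not> prime n"
  then obtain a b where "n = a * b" "a \<noteq> 1" "a \<noteq> n"
    using assms(1) by (auto simp: prime_nat_iff)
  then have ab: "n = a * b" "1 < a" "1 < b"
    using assms(1) by (cases a; cases b; auto)+
  then have "a < s \<or> b < s"
    using assms(2) mult_mono[of s a s b] by (fastforce simp: power2_eq_square)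
  moreover have "\<not> d < s" if "1 < d" "d dvd n" for d
    using that assms(3) by auto
  ultimately show False using ab by simp
qed

lemma two_primes_between:
  fixes n :: nat
  assumes "7 \<le> n"
  shows "\<exists>p q. prime p \<and> prime q \<and> n < p \<and> p < q \<and> q \<le> 2 * n"
proof (cases "2048 \<le> n")
  case True
  let ?D = "{p. prime p \<and> n < p \<and> p \<le> 2 * n}"
  have "\<not> card ?D \<le> 1" using two_primes_large[OF True] by simp
  then obtain p q where "p \<in> ?D" "q \<in> ?D" "p \<noteq> q"
    by (subst (asm) card_le_Suc0_iff_eq[unfolded One_nat_def[symmetric]]) auto
  then show ?thesis by (cases p q rule: linorder_cases) auto
next
  case False
  have *: ?thesis if "prime p" "prime q" "n < p" "p < q" "q \<le> 2 * n" for p q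
    using that by blast
  \<comment> \<open>Each range ends just below the smaller prime of its pair, and the larger prime
    is at most twice the lower end of the range.\<close>
  consider "7 \<le> n" "n < 11" | "11 \<le> n" "n < 17" | "17 \<le> n" "n < 29" |
    "29 \<le> n" "n < 47" | "47 \<le> n" "n < 83" | "83 \<le> n" "n < 157" |
    "157 \<le> n" "n < 311" | "311 \<le> n" "n < 617" | "617 \<le> n" "n < 1229" | "1229 \<le> n" "n < 2441"
    using False assms by linarith
  then show ?thesis
  proof cases
    case 1
    then show ?thesis by (intro *[of 11 13]) simp_all
  next
    case 2
    then show ?thesis by (intro *[of 17 19]) simp_all
  next
    case 3
    then show ?thesis by (intro *[of 29 31]) simp_all
  next
    case 4
    then show ?thesis by (intro *[of 47 53]) simp_all
  next
    case 5
    then show ?thesis by (intro *[of 83 89]) simp_all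
  next
    case 6
    then show ?thesis by (intro *[of 157 163]) simp_all
  next
    case 7
    have "prime (311::nat)" "prime (313::nat)"
      by (rule prime_nat_sqrtI[of _ 18]; simp add: upt_rec del: prime_nat_numeral_eq)+
    with 7 show ?thesis by (intro *[of 311 313]) (simp_all del: prime_nat_numeral_eq)
  next
    case 8
    have "prime (617::nat)" "prime (619::nat)"
      by (rule prime_nat_sqrtI[of _ 25]; simp add: upt_rec del: prime_nat_numeral_eq)+
    with 8 show ?thesis by (intro *[of 617 619]) (simp_all del: prime_nat_numeral_eq)
  next
    case 9
    have "prime (1229::nat)" "prime (1231::nat)"
      by (rule prime_nat_sqrtI[of _ 36]; simp add: upt_rec del: prime_nat_numeral_eq)+
    with 9 show ?thesis by (intro *[of 1229 1231]) (simp_all del: prime_nat_numeral_eq)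
  next
    case 10
    have "prime (2441::nat)" "prime (2447::nat)"
      by (rule prime_nat_sqrtI[of _ 50]; simp add: upt_rec del: prime_nat_numeral_eq)+
    with 10 show ?thesis by (intro *[of 2441 2447]) (simp_all del: prime_nat_numeral_eq)
  qed
qed

section \<open>The choice of \<open>p\<close> and \<open>q\<close> for a real bound
  \<open>c\<close>\<close>

lemma two_primes_above:
  fixes c :: real
  assumes "2 \<le> c"
  shows "\<exists>p q. prime p \<and> prime q \<and> c < real p \<and> p < q \<and> real (p * q) < c * real (p + q + 1)"
proof -
  define n where "n = nat \<lfloor>c\<rfloor>"
  have n: "real n \<le> c" "c < real n + 1" "2 \<le> n"
    using assms unfolding n_def by (linarith | simp add: le_nat_iff le_floor_iff)+
  \<comment> \<open>Rounding \<open>c\<close> down to \<open>n\<close> is harmless: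
    \<open>n < p\<close> gives \<open>c < n + 1 \<le> p\<close>, and the right-hand side of the
    product inequality increases with \<open>c\<close>.\<close>
  have *: ?thesis
    if "prime p" "prime q" "n < p" "p < q" "p * q < n * (p + q + 1)" for p q
  proof -
    have "real (p * q) < real (n * (p + q + 1))" using that(5) by (simp only: of_nat_less_iff)
    also have "\<dots> = real n * real (p + q + 1)" by (rule of_nat_mult)
    also have "\<dots> \<le> c * real (p + q + 1)" using n by (intro mult_right_mono) auto
    finally show ?thesis using that n by (intro exI[of _ p] exI[of _ q]) auto
  qed
  \<comment> \<open>For \<open>n = 2\<close>, \<open>3\<close> and \<open>5\<close> the interval
    \<open>(n, 2 * n]\<close> contains only one prime. The pairs used there have
    \<open>q > 2 * n\<close>, but still satisfy the product inequality.\<close>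
  consider "n = 2" | "n = 3" | "n = 4" | "n = 5" | "n = 6" | "7 \<le> n" using n by linarith
  then show ?thesis
  proof cases
    case 6
    then obtain p q where pq: "prime p" "prime q" "n < p" "p < q" "q \<le> 2 * n"
      using two_primes_between by blast
    have "2 * (p * q) = p * q + q * p" by simp
    also have "\<dots> \<le> p * (2 * n) + q * (2 * n)"
      using pq by (intro add_mono mult_left_mono) auto
    also have "\<dots> < 2 * (n * (p + q + 1))" using 6 by (simp add: algebra_simps)
    finally show ?thesis using pq * by simp
  qed (use *[of 3 5] *[of 5 7] *[of 7 11] in simp_all)
qed

section \<open>Deficient and abundant multiples\<close>

text \<open>The divisors of \<open>a * p\<close> are those of \<open>a\<close> and their multiples
  by \<open>p\<close>; the two sets are disjoint because \<open>p\<close> does not divide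
  \<open>a\<close>.\<close>

lemma divisor_sum_mult_prime:
  assumes "prime p" "\<not> p dvd a"
  shows "divisor_sum (a * p) = divisor_sum a * (p + 1)"
proof -
  have "0 < a" "0 < p" using assms by (auto intro: Nat.gr0I dest: prime_gt_0_nat)
  have "{d. d dvd a * p} = {d. d dvd a} \<union> (*) p ` {d. d dvd a}"
  proof (intro set_eqI iffI)
    fix d assume d: "d \<in> {d. d dvd a * p}"
    show "d \<in> {d. d dvd a} \<union> (*) p ` {d. d dvd a}"
    proof (cases "p dvd d")
      case True
      then show ?thesis using d \<open>0 < p\<close> by (auto elim!: dvdE[of p] simp: mult.commute)
    next
      case False
      then have "coprime d p" using assms(1) prime_imp_coprime coprime_commute by blast
      then show ?thesis using d by (simp add: coprime_dvd_mult_left_iff)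
    qed
  qed (auto simp: mult.commute)
  then have "divisor_sum (a * p) = sum id ({d. d dvd a} \<union> (*) p ` {d. d dvd a})"
    by (simp add: divisor_sum_def)
  also have "\<dots> = sum id {d. d dvd a} + sum id ((*) p ` {d. d dvd a})"
    using \<open>0 < a\<close> assms by (intro sum.union_disjoint) (auto dest: dvd_mult_left)
  also have "\<dots> = divisor_sum a * (p + 1)"
    using \<open>0 < p\<close> by (simp add: divisor_sum_def sum.reindex inj_on_def sum_distrib_left
      sum_distrib_right mult.commute distrib_right sum.distrib)
  finally show ?thesis .
qed

text \<open>Multiplication by \<open>k\<close> injects the divisors of \<open>d\<close> into those
  of \<open>k * d\<close>. So \<open>divisor_sum n / n\<close> cannot increase on passing to a
  divisor, which is why divisors inherit deficiency.\<close>

lemma mult_divisor_sum_le: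
  assumes "0 < k * d"
  shows "k * divisor_sum d \<le> divisor_sum (k * d)"
proof -
  have "k * divisor_sum d = sum id ((*) k ` {x. x dvd d})"
    using assms by (simp add: divisor_sum_def sum.reindex inj_on_def sum_distrib_left)
  also have "\<dots> \<le> sum id {x. x dvd k * d}"
    using assms by (intro sum_mono2) auto
  finally show ?thesis by (simp add: divisor_sum_def)
qed

lemma deficient_dvd:
  assumes "deficient n" "d dvd n"
  shows "deficient d"
proof -
  obtain k where k: "n = k * d" using assms(2) by (metis dvdE mult.commute)
  have "0 < n" using assms(1) by (auto simp: deficient_def intro: Nat.gr0I)
  then have "k * divisor_sum d \<le> divisor_sum n"
    unfolding k by (rule mult_divisor_sum_le)
  also have "\<dots> < k * (2 * d)" using assms(1) by (simp add: k deficient_def)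
  finally show ?thesis by (simp add: deficient_def)
qed

text \<open>With \<sigma> for \<open>divisor_sum m\<close>, the condition
  \<sigma>\<open>(p + 1) < 2 m p\<close> rearranges to
  \<sigma>\<open>< p (2 m -\<close>\<sigma>\<open>)\<close>; division by the positive deficiency
  gives the center.\<close>

lemma deficient_mult_prime_iff:
  assumes "deficient m" "prime p" "\<not> p dvd m"
  shows "deficient (m * p) \<longleftrightarrow> center m < real p"
proof -
  have D: "0 < real_of_int (deficiency m)"
    using assms(1) by (simp add: deficient_def deficiency_def)
  have "center m < real p \<longleftrightarrow> real (divisor_sum m) < real p * real_of_int (deficiency m)"
    using D by (simp add: center_def divide_less_eq)
  also have "\<dots> \<longleftrightarrow> real (divisor_sum m * (p + 1)) < real (2 * (m * p))"
    by (simp add: deficiency_def algebra_simps)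
  also have "\<dots> \<longleftrightarrow> deficient (m * p)"
    by (simp only: of_nat_less_iff deficient_def divisor_sum_mult_prime[OF assms(2,3)])
  finally show ?thesis by simp
qed

text \<open>Expanding \<open>(p + 1) * (q + 1)\<close> as \<open>p q + (p + q + 1)\<close> and
  moving the \<open>p q\<close> term across isolates the deficiency of \<open>m\<close>.\<close>

lemma abundant_mult_primes:
  assumes "deficient m" "prime p" "prime q" "p \<noteq> q" "\<not> p dvd m" "\<not> q dvd m"
    and "real (p * q) < center m * real (p + q + 1)"
  shows "abundant (m * p * q)"
proof -
  have D: "0 < real_of_int (deficiency m)"
    using assms(1) by (simp add: deficient_def deficiency_def)
  have "\<not> q dvd m * p"
    using assms by (auto simp: prime_dvd_mult_iff dest: primes_dvd_imp_eq)
  then have \<sigma>: "divisor_sum (m * p * q) = divisor_sum m * (p + 1) * (q + 1)"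
    using assms by (simp add: divisor_sum_mult_prime)
  have "real (p * q) * real_of_int (deficiency m) < real (divisor_sum m) * real (p + q + 1)"
    using assms(7) D by (simp add: center_def field_simps)
  then have "real (2 * (m * p * q)) < real (divisor_sum m * (p + 1) * (q + 1))"
    by (simp add: deficiency_def algebra_simps)
  then show ?thesis by (simp only: of_nat_less_iff abundant_def \<sigma>)
qed

text \<open>For a prime \<open>q\<close> not dividing \<open>a\<close>, the ratio
  \<open>divisor_sum n / n\<close> at \<open>n = a * q\<close> is that of \<open>a\<close> times
  \<open>1 + 1 / q\<close>, which decreases in \<open>q\<close>. The proof is the cross-multiplied
  form.\<close>

lemma deficient_replace_prime:
  assumes "deficient (a * s)" "prime s" "prime q" "s \<le> q" "\<not> s dvd a" "\<not> q dvd a"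
  shows "deficient (a * q)"
proof -
  have "s * (divisor_sum a * (q + 1)) \<le> q * (divisor_sum a * (s + 1))"
    using mult_left_mono[OF assms(4), of "divisor_sum a"] by (simp add: algebra_simps)
  also have "\<dots> < q * (2 * (a * s))"
    using assms by (simp add: deficient_def divisor_sum_mult_prime prime_gt_0_nat)
  finally have "s * divisor_sum (a * q) < s * (2 * (a * q))"
    using assms by (simp add: divisor_sum_mult_prime mult_ac)
  then show ?thesis by (simp add: deficient_def)
qed

text \<open>Every proper divisor divides \<open>n / s\<close> for some prime \<open>s\<close>, so by
  inheritance of deficiency only these maximal proper divisors have to be tested.\<close>

lemma primitive_abundantI:
  assumes "abundant n" "\<And>k s. prime s \<Longrightarrow> n = k * s \<Longrightarrow> deficient k"
  shows "primitive_abundant n"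
  unfolding primitive_abundant_def
proof (intro conjI allI impI)
  fix d assume "d dvd n \<and> d \<noteq> n"
  then obtain j where j: "n = d * j" "j \<noteq> 1" by (metis dvdE mult.right_neutral)
  then obtain s where s: "prime s" "s dvd j" using prime_factor_nat by blast
  then obtain i where "j = s * i" by (metis dvdE mult.right_neutral)
  then have "n = (d * i) * s" using j by simp
  then have "deficient (d * i)" using assms(2) s(1) by blast
  then show "deficient d" by (rule deficient_dvd) simp
qed (fact assms(1))

theorem theorem3p3:
  fixes m r :: nat and pbar e :: "nat \<Rightarrow> nat"
  assumes "r \<ge> 1"
    and "\<And>i. i \<in> {1..r} \<Longrightarrow> prime (pbar i)"
    and "strict_mono_on {1..r} pbar"
    and "\<And>i. i \<in> {1..r} \<Longrightarrow> e i \<ge> 1"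
    and "m = (\<Prod>i = 1..r. pbar i ^ e i)"
    and "deficient m"
    and "center m \<ge> real (pbar r)"
  shows "\<exists>p q :: nat. prime p \<and> prime q \<and> pbar r < p \<and> p < q \<and>
           deficient (m * p) \<and> abundant (m * p * q) \<and>
           (squarefree m \<longrightarrow> primitive_abundant (m * p * q))"
proof -
  \<comment> \<open>This makes every prime above \<open>pbar r\<close> coprime to \<open>m\<close>,
    so \<open>p\<close> and \<open>q\<close> are new factors.\<close>
  have factor_le: "s \<le> pbar r" if s: "prime s" "s dvd m" for s
  proof -
    have "\<exists>i\<in>{1..r}. s dvd pbar i ^ e i"
      using s unfolding assms(5) by (subst (asm) prime_dvd_prod_iff) auto
    then obtain i where i: "i \<in> {1..r}" "s dvd pbar i" using s(1) prime_dvd_power by blast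
    then have "s = pbar i" using s(1) assms(2) primes_dvd_imp_eq by blast
    also have "\<dots> \<le> pbar r"
      using i(1) assms(1) by (intro strict_mono_on_leD[OF assms(3)]) auto
    finally show ?thesis .
  qed
  have "2 \<le> pbar r" using assms(1,2) by (intro prime_ge_2_nat) auto
  then have "2 \<le> center m" using assms(7) by linarith
  then obtain p q where pq: "prime p" "prime q" "center m < real p" "p < q"
    "real (p * q) < center m * real (p + q + 1)"
    using two_primes_above by blast
  have gt: "pbar r < p" using pq(3) assms(7) by linarith
  have ndvd: "\<not> p dvd m" "\<not> q dvd m"
    using factor_le[of p] factor_le[of q] pq gt by linarith+
  have def_p: "deficient (m * p)" and def_q: "deficient (m * q)"
    using deficient_mult_prime_iff[OF assms(6)] pq ndvd by auto
  have ab: "abundant (m * p * q)"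
    using pq ndvd assms(6) by (intro abundant_mult_primes) auto
  have "primitive_abundant (m * p * q)" if sf: "squarefree m"
    using ab
  proof (rule primitive_abundantI)
    fix k s assume s: "prime s" and k: "m * p * q = k * s"
    have "s > 0" using s by (rule prime_gt_0_nat)
    have "s dvd m * p * q" unfolding k by simp
    then consider "s = q" | "s = p" | "s dvd m"
      using s pq(1,2) by (auto simp: prime_dvd_mult_iff dest: primes_dvd_imp_eq)
    then show "deficient k"
    proof cases
      case 1
      then show ?thesis using k \<open>s > 0\<close> def_p by simp
    next
      case 2
      then have "m * q * s = k * s" using k by (simp add: mult_ac)
      then show ?thesis using \<open>s > 0\<close> def_q by simp
    next
      case 3
      then obtain a where a: "m = a * s" by (metis dvdE mult.commute)
      have "a * p * q * s = k * s" using k by (simp add: a mult_ac)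
      then have k: "k = a * p * q" using \<open>s > 0\<close> by simp
      \<comment> \<open>Square-freeness enters here: \<open>s\<close> is a simple factor of
        \<open>m * p = a * p * s\<close>, so it can be exchanged for the larger \<open>q\<close>,
        which yields \<open>k\<close>.\<close>
      have "\<not> s dvd a"
        using sf s squarefreeD[of m s] by (auto simp: a power2_eq_square mult_dvd_mono)
      moreover have "s < p" using factor_le[OF s 3] gt by simp
      ultimately have "\<not> s dvd a * p" "\<not> q dvd a * p"
        using s pq ndvd by (auto simp: a prime_dvd_mult_iff dest: primes_dvd_imp_eq)
      moreover have "deficient (a * p * s)" using def_p by (simp add: a mult_ac)
      ultimately show ?thesis
        unfolding k using s pq \<open>s < p\<close> by (intro deficient_replace_prime[of "a * p" s q]) auto
    qed
  qed
  with pq gt def_p ab show ?thesis by blast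
qed

end
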